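(* Let $\mathfrak{g}$ be a finite-dimensional quadratic Lie algebra over $\mathbb{C}$. For all elements $\mathbf{x}$ of $\mathfrak{g}_\infty$, the sequence $(\dim\mathfrak{g}_m^{\mathbf{x}(m)})_{m\in\mathbb{N}}$ is concave.
   Context: Natural numbers include $0$. A Lie algebra is quadratic if it admits a non-degenerate symmetric bilinear form $K$ that is invariant, i.e. $K([x,y],z)=K(x,[y,z])$ for all $x,y,z$. For a finite-dimensional complex Lie algebra $\mathfrak{g}$, let $\mathfrak{g}_\infty=\mathfrak{g}\otimes\mathbb{C}[T]$ be the Lie algebra with bracket extended $\mathbb{C}[T]$-bilinearly; its elements are written $\mathbf{x}=\sum_{k\in\mathbb{N}}x_k\otimes T^k$ with $x_k\in\mathfrak{g}$ (finitely many nonzero). For $m\in\mathbb{N}$ let $\mathfrak{g}_m=\mathfrak{g}_\infty/(\mathfrak{g}\otimes T^{m+1}\mathbb{C}[T])$ (the $m$-th generalized Takiff Lie algebra; $\mathfrak{g}_0=\mathfrak{g}$), and let $\mathbf{x}(m)=(x_0,\dots,x_m)$ be the image of $\mathbf{x}$ in $\mathfrak{g}_m$. For an element $z$ of a Lie algebra $\mathfrak{h}$, $\mathfrak{h}^z$ is its centralizer in $\mathfrak{h}$. A sequence of real numbers $(u_m)_{m\in\mathbb{N}}$ is concave if $u_{m+2}+u_m\leq 2u_{m+1}$ for all $m\in\mathbb{N}$ (including $m=0$). *)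

theory Defs
  imports "Jordan_Normal_Form.VS_Connect" "HOL-Algebra.QuotRing"
begin

text \<open>
  A Lie algebra over a field \<open>K\<close> is a vector space over \<open>K\<close> with an additional bracket. As usual for
  modules in HOL-Algebra, the fields \<open>mult\<close> and \<open>one\<close> of the record are junk: no axiom mentions them.
\<close>

record ('k, 'v) lie_algebra = "('k, 'v) module" +
  lie_bracket :: "'v \<Rightarrow> 'v \<Rightarrow> 'v" (\<open>\<lbrakk>_,/ _\<rbrakk>\<index>\<close>)

locale lie_algebra = vectorspace K L
  for K :: "('k, 'b) ring_scheme" and L :: "('k, 'v, 'c) lie_algebra_scheme" (structure) +
  assumes bracket_closed [simp, intro]:
      "\<lbrakk>x \<in> carrier L; y \<in> carrier L\<rbrakk> \<Longrightarrow> \<lbrakk>x, y\<rbrakk> \<in> carrier L"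
    and bracket_add_left:
      "\<lbrakk>x \<in> carrier L; y \<in> carrier L; z \<in> carrier L\<rbrakk> \<Longrightarrow> \<lbrakk>x \<oplus> y, z\<rbrakk> = \<lbrakk>x, z\<rbrakk> \<oplus> \<lbrakk>y, z\<rbrakk>"
    and bracket_add_right:
      "\<lbrakk>x \<in> carrier L; y \<in> carrier L; z \<in> carrier L\<rbrakk> \<Longrightarrow> \<lbrakk>x, y \<oplus> z\<rbrakk> = \<lbrakk>x, y\<rbrakk> \<oplus> \<lbrakk>x, z\<rbrakk>"
    and bracket_smult_left:
      "\<lbrakk>a \<in> carrier K; x \<in> carrier L; y \<in> carrier L\<rbrakk> \<Longrightarrow> \<lbrakk>a \<odot> x, y\<rbrakk> = a \<odot> \<lbrakk>x, y\<rbrakk>"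
    and bracket_smult_right:
      "\<lbrakk>a \<in> carrier K; x \<in> carrier L; y \<in> carrier L\<rbrakk> \<Longrightarrow> \<lbrakk>x, a \<odot> y\<rbrakk> = a \<odot> \<lbrakk>x, y\<rbrakk>"
    and bracket_self: "x \<in> carrier L \<Longrightarrow> \<lbrakk>x, x\<rbrakk> = \<zero>"
    and jacobi:
      "\<lbrakk>x \<in> carrier L; y \<in> carrier L; z \<in> carrier L\<rbrakk> \<Longrightarrow>
        \<lbrakk>x, \<lbrakk>y, z\<rbrakk>\<rbrakk> \<oplus> \<lbrakk>y, \<lbrakk>z, x\<rbrakk>\<rbrakk> \<oplus> \<lbrakk>z, \<lbrakk>x, y\<rbrakk>\<rbrakk> = \<zero>"

definition bilinear_form ::
  "('k, 'b) ring_scheme \<Rightarrow> ('k, 'v, 'c) module_scheme \<Rightarrow> ('v \<Rightarrow> 'v \<Rightarrow> 'k) \<Rightarrow> bool" where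
  "bilinear_form K V B \<longleftrightarrow>
     (\<forall>x\<in>carrier V. \<forall>y\<in>carrier V. B x y \<in> carrier K) \<and>
     (\<forall>x\<in>carrier V. \<forall>y\<in>carrier V. \<forall>z\<in>carrier V.
        B (x \<oplus>\<^bsub>V\<^esub> y) z = B x z \<oplus>\<^bsub>K\<^esub> B y z \<and> B x (y \<oplus>\<^bsub>V\<^esub> z) = B x y \<oplus>\<^bsub>K\<^esub> B x z) \<and>
     (\<forall>a\<in>carrier K. \<forall>x\<in>carrier V. \<forall>y\<in>carrier V.
        B (a \<odot>\<^bsub>V\<^esub> x) y = a \<otimes>\<^bsub>K\<^esub> B x y \<and> B x (a \<odot>\<^bsub>V\<^esub> y) = a \<otimes>\<^bsub>K\<^esub> B x y)"

definition symmetric_form ::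
  "('k, 'v, 'c) module_scheme \<Rightarrow> ('v \<Rightarrow> 'v \<Rightarrow> 'k) \<Rightarrow> bool" where
  "symmetric_form V B \<longleftrightarrow> (\<forall>x\<in>carrier V. \<forall>y\<in>carrier V. B x y = B y x)"

text \<open>For the symmetric forms considered here, left and right radical coincide.\<close>

definition nondegenerate_form ::
  "('k, 'b) ring_scheme \<Rightarrow> ('k, 'v, 'c) module_scheme \<Rightarrow> ('v \<Rightarrow> 'v \<Rightarrow> 'k) \<Rightarrow> bool" where
  "nondegenerate_form K V B \<longleftrightarrow>
     (\<forall>x\<in>carrier V. (\<forall>y\<in>carrier V. B x y = \<zero>\<^bsub>K\<^esub>) \<longrightarrow> x = \<zero>\<^bsub>V\<^esub>)"

definition invariant_form ::
  "('k, 'v, 'c) lie_algebra_scheme \<Rightarrow> ('v \<Rightarrow> 'v \<Rightarrow> 'k) \<Rightarrow> bool" where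
  "invariant_form L B \<longleftrightarrow>
     (\<forall>x\<in>carrier L. \<forall>y\<in>carrier L. \<forall>z\<in>carrier L. B (\<lbrakk>x, y\<rbrakk>\<^bsub>L\<^esub>) z = B x (\<lbrakk>y, z\<rbrakk>\<^bsub>L\<^esub>))"

locale quadratic_lie_algebra = lie_algebra K L
  for K :: "('k, 'b) ring_scheme" and L :: "('k, 'v, 'c) lie_algebra_scheme" (structure) +
  assumes ex_form: "\<exists>B. bilinear_form K L B \<and> symmetric_form L B \<and> nondegenerate_form K L B \<and>
    invariant_form L B"

definition lie_centralizer :: "('k, 'v, 'c) lie_algebra_scheme \<Rightarrow> 'v \<Rightarrow> 'v set" where
  "lie_centralizer L z = {y \<in> carrier L. \<lbrakk>z, y\<rbrakk>\<^bsub>L\<^esub> = \<zero>\<^bsub>L\<^esub>}"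

definition centralizer_dim ::
  "('k, 'b) ring_scheme \<Rightarrow> ('k, 'v, 'c) lie_algebra_scheme \<Rightarrow> 'v \<Rightarrow> nat" where
  "centralizer_dim K L z = vectorspace.dim K (L\<lparr>carrier := lie_centralizer L z\<rparr>)"

locale lie_ideal = lie_algebra K L + subspace K I L
  for K :: "('k, 'b) ring_scheme" and I :: "'v set" and L :: "('k, 'v, 'c) lie_algebra_scheme" (structure) +
  assumes ideal_bracket: "\<lbrakk>x \<in> carrier L; y \<in> I\<rbrakk> \<Longrightarrow> \<lbrakk>x, y\<rbrakk> \<in> I"

text \<open>
  The quotient by an ideal, on cosets, in the style of \<^const>\<open>FactRing\<close>. For an ideal \<open>I\<close> the unions
  below run over equal cosets; for \<open>smult\<close>, adding \<open>I\<close> matters when the scalar is zero.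
\<close>

definition lie_quotient ::
  "('k, 'v, 'c) lie_algebra_scheme \<Rightarrow> 'v set \<Rightarrow> ('k, 'v set) lie_algebra" where
  "lie_quotient L I =
     \<lparr>carrier = a_rcosets\<^bsub>L\<^esub> I, mult = undefined, one = undefined,
      zero = I, add = set_add L,
      module.smult = (\<lambda>a X. \<Union>x\<in>X. I +>\<^bsub>L\<^esub> (a \<odot>\<^bsub>L\<^esub> x)),
      lie_bracket = (\<lambda>X Y. \<Union>x\<in>X. \<Union>y\<in>Y. I +>\<^bsub>L\<^esub> \<lbrakk>x, y\<rbrakk>\<^bsub>L\<^esub>)\<rparr>"

text \<open>
  \<open>L \<otimes> K[T]\<close>: the element \<open>\<Sum>k. x\<^sub>k \<otimes> T\<^sup>k\<close> is represented by its finitely supported coefficient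
  sequence \<open>x\<close>. The bracket is determined by
  \<open>\<lbrakk>u \<otimes> T\<^sup>i, v \<otimes> T\<^sup>j\<rbrakk> = \<lbrakk>u, v\<rbrakk> \<otimes> T\<^sup>i\<^sup>+\<^sup>j\<close>.
\<close>

definition takiff_inf :: "('k, 'v, 'c) lie_algebra_scheme \<Rightarrow> ('k, nat \<Rightarrow> 'v) lie_algebra" where
  "takiff_inf L =
     \<lparr>carrier = {x. (\<forall>k. x k \<in> carrier L) \<and> finite {k. x k \<noteq> \<zero>\<^bsub>L\<^esub>}},
      mult = undefined, one = undefined,
      zero = (\<lambda>k. \<zero>\<^bsub>L\<^esub>), add = (\<lambda>x y k. x k \<oplus>\<^bsub>L\<^esub> y k),
      module.smult = (\<lambda>a x k. a \<odot>\<^bsub>L\<^esub> x k),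
      lie_bracket = (\<lambda>x y k. \<Oplus>\<^bsub>L\<^esub>i\<in>{..k}. \<lbrakk>x i, y (k - i)\<rbrakk>\<^bsub>L\<^esub>)\<rparr>"

text \<open>\<open>takiff_ideal L m\<close> is \<open>L \<otimes> T\<^sup>m\<^sup>+\<^sup>1 K[T]\<close>.\<close>

definition takiff_ideal :: "('k, 'v, 'c) lie_algebra_scheme \<Rightarrow> nat \<Rightarrow> (nat \<Rightarrow> 'v) set" where
  "takiff_ideal L m = {x \<in> carrier (takiff_inf L). \<forall>k\<le>m. x k = \<zero>\<^bsub>L\<^esub>}"

definition takiff :: "('k, 'v, 'c) lie_algebra_scheme \<Rightarrow> nat \<Rightarrow> ('k, (nat \<Rightarrow> 'v) set) lie_algebra" where
  "takiff L m = lie_quotient (takiff_inf L) (takiff_ideal L m)"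

definition takiff_proj ::
  "('k, 'v, 'c) lie_algebra_scheme \<Rightarrow> nat \<Rightarrow> (nat \<Rightarrow> 'v) \<Rightarrow> (nat \<Rightarrow> 'v) set" where
  "takiff_proj L m x = takiff_ideal L m +>\<^bsub>takiff_inf L\<^esub> x"

context lie_algebra
begin

lemma bracket_skew:
  assumes "x \<in> carrier L" "y \<in> carrier L"
  shows "\<lbrakk>y, x\<rbrakk> = \<ominus> \<lbrakk>x, y\<rbrakk>"
proof -
  have "\<lbrakk>x \<oplus> y, x \<oplus> y\<rbrakk> = \<lbrakk>x, y\<rbrakk> \<oplus> \<lbrakk>y, x\<rbrakk>"
    using assms by (simp add: bracket_add_left bracket_add_right bracket_self[of x] bracket_self[of y] a_ac)
  then have "\<zero> = \<lbrakk>x, y\<rbrakk> \<oplus> \<lbrakk>y, x\<rbrakk>" using assms by (simp add: bracket_self)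
  then show ?thesis using assms by (metis bracket_closed minus_equality add.m_comm)
qed

end

lemma (in lie_ideal) ideal_abelian_subgroup: "abelian_subgroup I L"
proof (rule abelian_subgroupI3[OF additive_subgroupI])
  interpret S: submodule K I L
    using subspace.submod[OF subspace_axioms] .
  show "subgroup I (add_monoid L)"
  proof (rule add.subgroupI)
    show "I \<subseteq> carrier L" by (rule S.subset)
    show "I \<noteq> {}" using S.zero_closed by blast
    fix a assume a: "a \<in> I"
    then have "a \<in> carrier L" using S.subset by blast
    then have "\<ominus> a = (\<ominus>\<^bsub>K\<^esub> \<one>\<^bsub>K\<^esub>) \<odot> a"
      by (simp add: smult_l_minus)
    then show "\<ominus> a \<in> I" using a by (simp add: S.smult_closed)
  next
    fix a b assume "a \<in> I" "b \<in> I"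
    then show "a \<oplus> b \<in> I" by (rule S.m_closed)
  qed
qed unfold_locales

sublocale lie_ideal \<subseteq> Q: abelian_subgroup I L
  by (rule ideal_abelian_subgroup)

context lie_ideal
begin

lemma coset_elem:
  assumes "x \<in> carrier L" "x' \<in> I +> x"
  obtains i where "i \<in> I" "x' = i \<oplus> x"
  using assms by (auto simp: a_r_coset_def')

lemma coset_eqI: "\<lbrakk>i \<in> I; x \<in> carrier L\<rbrakk> \<Longrightarrow> I +> (i \<oplus> x) = I +> x"
  using a_coset_add_assoc[OF Q.a_subset, of i x] a_coset_join2[OF _ Q.a_subgroup, of i] by auto

lemma quotient_add:
  "\<lbrakk>x \<in> carrier L; y \<in> carrier L\<rbrakk> \<Longrightarrow> (I +> x) \<oplus>\<^bsub>lie_quotient L I\<^esub> (I +> y) = I +> (x \<oplus> y)"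
  by (simp add: lie_quotient_def Q.a_rcos_sum)

lemma UN_coset_const:
  assumes "x \<in> carrier L" "\<And>x'. x' \<in> I +> x \<Longrightarrow> F x' = C"
  shows "(\<Union>x'\<in>I +> x. F x') = C"
proof -
  have "F ` (I +> x) = {C}" using assms(2) Q.a_rcos_self[OF assms(1)] by blast
  then show ?thesis by (metis cSup_singleton)
qed

lemma quotient_smult:
  assumes "a \<in> carrier K" "x \<in> carrier L"
  shows "a \<odot>\<^bsub>lie_quotient L I\<^esub> (I +> x) = I +> (a \<odot> x)"
proof -
  have "I +> (a \<odot> x') = I +> (a \<odot> x)" if x': "x' \<in> I +> x" for x'
  proof -
    obtain i where i: "i \<in> I" "x' = i \<oplus> x" by (rule coset_elem[OF assms(2) x'])
    have c: "i \<in> carrier L" using i(1) by (rule Q.a_Hcarr)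
    have ai: "a \<odot> i \<in> I"
      by (rule submodule.smult_closed[OF subspace.submod[OF subspace_axioms] assms(1) i(1)])
    have "a \<odot> x' = a \<odot> i \<oplus> a \<odot> x"
      unfolding i(2) by (rule smult_r_distr[OF assms(1) c assms(2)])
    then show ?thesis using coset_eqI[OF ai smult_closed[OF assms]] by simp
  qed
  then have "(\<Union>x'\<in>I +> x. I +> (a \<odot> x')) = I +> (a \<odot> x)" by (rule UN_coset_const[OF assms(2)])
  then show ?thesis by (simp add: lie_quotient_def)
qed

lemma quotient_bracket:
  assumes "x \<in> carrier L" "y \<in> carrier L"
  shows "\<lbrakk>I +> x, I +> y\<rbrakk>\<^bsub>lie_quotient L I\<^esub> = I +> \<lbrakk>x, y\<rbrakk>"
proof -
  have "I +> \<lbrakk>x', y'\<rbrakk> = I +> \<lbrakk>x, y\<rbrakk>" if x': "x' \<in> I +> x" and y': "y' \<in> I +> y" for x' y'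
  proof -
    obtain i where i: "i \<in> I" "x' = i \<oplus> x" by (rule coset_elem[OF assms(1) x'])
    obtain j where j: "j \<in> I" "y' = j \<oplus> y" by (rule coset_elem[OF assms(2) y'])
    have c: "i \<in> carrier L" "j \<in> carrier L" using i j by auto
    have "\<lbrakk>i, y'\<rbrakk> = \<ominus> \<lbrakk>y', i\<rbrakk>" using c assms j by (intro bracket_skew) auto
    then have 1: "\<lbrakk>i, y'\<rbrakk> \<in> I" using c assms j i by (simp add: ideal_bracket)
    have 2: "\<lbrakk>x, j\<rbrakk> \<in> I" using assms j by (simp add: ideal_bracket)
    have "\<lbrakk>x', y'\<rbrakk> = \<lbrakk>i, y'\<rbrakk> \<oplus> (\<lbrakk>x, j\<rbrakk> \<oplus> \<lbrakk>x, y\<rbrakk>)"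
      using c assms i j by (simp add: bracket_add_left bracket_add_right a_ac)
    then show ?thesis using 1 2 assms c by (simp add: coset_eqI)
  qed
  then have "(\<Union>x'\<in>I +> x. \<Union>y'\<in>I +> y. I +> \<lbrakk>x', y'\<rbrakk>) = I +> \<lbrakk>x, y\<rbrakk>"
    using assms by (intro UN_coset_const) blast+
  then show ?thesis by (simp add: lie_quotient_def)
qed

lemma quotient_carrier: "carrier (lie_quotient L I) = (\<lambda>x. I +> x) ` carrier L"
  by (auto simp: lie_quotient_def A_RCOSETS_def')

lemma quotient_zero: "\<zero>\<^bsub>lie_quotient L I\<^esub> = I +> \<zero>"
  using Q.a_subset by (simp add: lie_quotient_def)

lemma quotient_rep:
  assumes "X \<in> carrier (lie_quotient L I)"
  obtains x where "x \<in> carrier L" "X = I +> x"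
  using assms by (auto simp: quotient_carrier)

lemma quotient_in_carrier: "x \<in> carrier L \<Longrightarrow> I +> x \<in> carrier (lie_quotient L I)"
  by (simp add: quotient_carrier)

lemma lie_quotient_lie_algebra: "lie_algebra K (lie_quotient L I)"
proof -
  let ?Q = "lie_quotient L I"
  note q = quotient_in_carrier quotient_add quotient_smult quotient_bracket quotient_zero
  have "module K ?Q"
  proof (rule module_criteria, goal_cases)
    case 1 show ?case by (rule R.is_cring)
  next
    case 2 show ?case by (simp only: q zero_closed)
  next
    case 3 show ?case by (metis quotient_rep quotient_add quotient_in_carrier a_closed)
  next
    case 4
    show ?case
    proof
      fix v assume "v \<in> carrier ?Q"
      then obtain x where x: "x \<in> carrier L" "v = I +> x" by (rule quotient_rep)
      show "\<exists>w\<in>carrier ?Q. v \<oplus>\<^bsub>?Q\<^esub> w = \<zero>\<^bsub>?Q\<^esub>"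
        using x by (intro bexI[of _ "I +> (\<ominus> x)"]) (simp_all only: q a_inv_closed r_neg)
    qed
  next
    case 5 show ?case by (metis quotient_rep quotient_smult quotient_in_carrier smult_closed)
  next
    case 6 show ?case by (metis quotient_rep quotient_add a_comm)
  next
    case 7
    show ?case
    proof (intro allI impI, elim conjE)
      fix v w z assume "v \<in> carrier ?Q" "w \<in> carrier ?Q" "z \<in> carrier ?Q"
      then show "v \<oplus>\<^bsub>?Q\<^esub> w \<oplus>\<^bsub>?Q\<^esub> z = v \<oplus>\<^bsub>?Q\<^esub> (w \<oplus>\<^bsub>?Q\<^esub> z)"
        by (elim quotient_rep) (simp only: q a_closed a_assoc)
    qed
  next
    case 8
    show ?case by (metis quotient_rep quotient_add quotient_zero zero_closed r_zero)
  next
    case 9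
    show ?case
    proof (intro allI impI, elim conjE)
      fix a b v assume "a \<in> carrier K" "b \<in> carrier K" "v \<in> carrier ?Q"
      then show "(a \<otimes>\<^bsub>K\<^esub> b) \<odot>\<^bsub>?Q\<^esub> v = a \<odot>\<^bsub>?Q\<^esub> (b \<odot>\<^bsub>?Q\<^esub> v)"
        by (elim quotient_rep) (simp only: q smult_closed R.m_closed smult_assoc1)
    qed
  next
    case 10
    show ?case by (metis quotient_rep quotient_smult R.one_closed smult_one)
  next
    case 11
    show ?case
    proof (intro allI impI, elim conjE)
      fix a b v assume "a \<in> carrier K" "b \<in> carrier K" "v \<in> carrier ?Q"
      then show "(a \<oplus>\<^bsub>K\<^esub> b) \<odot>\<^bsub>?Q\<^esub> v = a \<odot>\<^bsub>?Q\<^esub> v \<oplus>\<^bsub>?Q\<^esub> b \<odot>\<^bsub>?Q\<^esub> v"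
        by (elim quotient_rep) (simp only: q smult_closed R.a_closed smult_l_distr)
    qed
  next
    case 12
    show ?case
    proof (intro allI impI, elim conjE)
      fix a v w assume "a \<in> carrier K" "v \<in> carrier ?Q" "w \<in> carrier ?Q"
      then show "a \<odot>\<^bsub>?Q\<^esub> (v \<oplus>\<^bsub>?Q\<^esub> w) = a \<odot>\<^bsub>?Q\<^esub> v \<oplus>\<^bsub>?Q\<^esub> a \<odot>\<^bsub>?Q\<^esub> w"
        by (elim quotient_rep) (simp only: q smult_closed a_closed smult_r_distr)
    qed
  qed
  then have "vectorspace K ?Q" by (simp add: vectorspace_def field_axioms)
  then show ?thesis
  proof (intro lie_algebra.intro lie_algebra_axioms.intro, goal_cases)
    case (2 x y) then show ?case by (elim quotient_rep) (simp only: q bracket_closed)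
  next
    case (3 x y z) then show ?case
      by (elim quotient_rep) (simp only: q bracket_closed a_closed bracket_add_left)
  next
    case (4 x y z) then show ?case
      by (elim quotient_rep) (simp only: q bracket_closed a_closed bracket_add_right)
  next
    case (5 a x y) then show ?case
      by (elim quotient_rep) (simp only: q bracket_closed smult_closed bracket_smult_left)
  next
    case (6 a x y) then show ?case
      by (elim quotient_rep) (simp only: q bracket_closed smult_closed bracket_smult_right)
  next
    case (7 x) then show ?case by (elim quotient_rep) (simp only: q bracket_self)
  next
    case (8 x y z) then show ?case
      by (elim quotient_rep) (simp only: q bracket_closed a_closed jacobi)
  qed
qed

end

context lie_algebra
begin

lemma bracket_zero_right [simp]: "x \<in> carrier L \<Longrightarrow> \<lbrakk>x, \<zero>\<rbrakk> = \<zero>"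
  using bracket_smult_right[of "\<zero>\<^bsub>K\<^esub>" x \<zero>] by simp

lemma bracket_zero_left [simp]: "x \<in> carrier L \<Longrightarrow> \<lbrakk>\<zero>, x\<rbrakk> = \<zero>"
  using bracket_smult_left[of "\<zero>\<^bsub>K\<^esub>" \<zero> x] by simp

lemma bracket_finsum:
  assumes "finite A" "f \<in> A \<rightarrow> carrier L" "x \<in> carrier L"
  shows "\<lbrakk>x, finsum L f A\<rbrakk> = (\<Oplus>i\<in>A. \<lbrakk>x, f i\<rbrakk>)"
  using assms
proof (induction A rule: finite_induct)
  case (insert a A)
  then show ?case by (simp add: bracket_add_right Pi_def)
qed simp

lemma smult_finsum:
  assumes "finite A" "f \<in> A \<rightarrow> carrier L" "a \<in> carrier K"
  shows "a \<odot> finsum L f A = (\<Oplus>i\<in>A. a \<odot> f i)"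
  using assms
proof (induction A rule: finite_induct)
  case (insert a A)
  then show ?case by (simp add: smult_r_distr Pi_def)
qed simp

lemma takiff_inf_coeff: "x \<in> carrier (takiff_inf L) \<Longrightarrow> x k \<in> carrier L"
  by (simp add: takiff_inf_def)

lemma conv_eq:
  fixes n N :: nat
  assumes "\<And>k. x k \<in> carrier L" "\<And>k. y k \<in> carrier L" "n \<le> N"
  shows "(\<Oplus>i\<in>{..n}. \<lbrakk>x i, y (n - i)\<rbrakk>) =
    (\<Oplus>i\<in>{..N}. \<Oplus>j\<in>{..N}. if i + j = n then \<lbrakk>x i, y j\<rbrakk> else \<zero>)"
proof -
  have inner: "(\<Oplus>j\<in>{..N}. if i + j = n then \<lbrakk>x i, y j\<rbrakk> else \<zero>) = (if i \<le> n then \<lbrakk>x i, y (n - i)\<rbrakk> else \<zero>)"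
    for i
  proof (cases "i \<le> n")
    case True
    have "(\<Oplus>j\<in>{..N}. if i + j = n then \<lbrakk>x i, y j\<rbrakk> else \<zero>) =
        (\<Oplus>j\<in>{..N}. if n - i = j then \<lbrakk>x i, y j\<rbrakk> else \<zero>)"
    proof (rule finsum_cong'[OF refl])
      show "(\<lambda>j. if n - i = j then \<lbrakk>x i, y j\<rbrakk> else \<zero>) \<in> {..N} \<rightarrow> carrier L" using assms by simp
      fix j
      have "i + j = n \<longleftrightarrow> n - i = j" using True by linarith
      then show "(if i + j = n then \<lbrakk>x i, y j\<rbrakk> else \<zero>) = (if n - i = j then \<lbrakk>x i, y j\<rbrakk> else \<zero>)"
        by simp
    qed
    also have "\<dots> = \<lbrakk>x i, y (n - i)\<rbrakk>"
      by (rule add.finprod_singleton) (use assms in simp_all)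
    finally show ?thesis using True by simp
  next
    case False
    have "(\<Oplus>j\<in>{..N}. if i + j = n then \<lbrakk>x i, y j\<rbrakk> else \<zero>) = \<zero>"
      using False by (intro add.finprod_one_eqI) simp
    then show ?thesis using False by simp
  qed
  have "(\<Oplus>i\<in>{..N}. \<Oplus>j\<in>{..N}. if i + j = n then \<lbrakk>x i, y j\<rbrakk> else \<zero>) =
     (\<Oplus>i\<in>{..N}. if i \<le> n then \<lbrakk>x i, y (n - i)\<rbrakk> else \<zero>)"
    unfolding inner ..
  also have "\<dots> = (\<Oplus>i\<in>{..n}. \<lbrakk>x i, y (n - i)\<rbrakk>)"
    using assms by - (rule add.finprod_mono_neutral_cong_right, simp_all add: Pi_def)
  finally show ?thesis by simp
qed

lemma conv_eq3:
  fixes n :: nat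
  assumes "\<And>k. x k \<in> carrier L" "\<And>k. y k \<in> carrier L" "\<And>k. z k \<in> carrier L"
  shows "(\<Oplus>i\<in>{..n}. \<lbrakk>x i, \<Oplus>j\<in>{..n - i}. \<lbrakk>y j, z (n - i - j)\<rbrakk>\<rbrakk>) =
    (\<Oplus>i\<in>{..n}. \<Oplus>j\<in>{..n}. \<Oplus>k\<in>{..n}. if i + j + k = n then \<lbrakk>x i, \<lbrakk>y j, z k\<rbrakk>\<rbrakk> else \<zero>)"
proof (rule finsum_cong'[OF refl])
  fix i assume i: "i \<in> {..n}"
  have "\<lbrakk>x i, \<Oplus>j\<in>{..n - i}. \<lbrakk>y j, z (n - i - j)\<rbrakk>\<rbrakk> =
     \<lbrakk>x i, \<Oplus>j\<in>{..n}. \<Oplus>k\<in>{..n}. if j + k = n - i then \<lbrakk>y j, z k\<rbrakk> else \<zero>\<rbrakk>"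
    using assms by (subst conv_eq[of y z "n - i" n]) auto
  also have "\<dots> = (\<Oplus>j\<in>{..n}. \<Oplus>k\<in>{..n}. \<lbrakk>x i, if j + k = n - i then \<lbrakk>y j, z k\<rbrakk> else \<zero>\<rbrakk>)"
    using assms by (subst bracket_finsum; (intro finsum_cong' bracket_finsum)?) (auto simp: Pi_def)
  also have "\<dots> = (\<Oplus>j\<in>{..n}. \<Oplus>k\<in>{..n}. if i + j + k = n then \<lbrakk>x i, \<lbrakk>y j, z k\<rbrakk>\<rbrakk> else \<zero>)"
    using assms i by (intro finsum_cong') (auto simp: Pi_def)
  finally show "\<lbrakk>x i, \<Oplus>j\<in>{..n - i}. \<lbrakk>y j, z (n - i - j)\<rbrakk>\<rbrakk> =
    (\<Oplus>j\<in>{..n}. \<Oplus>k\<in>{..n}. if i + j + k = n then \<lbrakk>x i, \<lbrakk>y j, z k\<rbrakk>\<rbrakk> else \<zero>)" .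
qed (use assms in \<open>auto simp: Pi_def\<close>)

lemma finsum3_cyc:
  assumes "\<And>i j k. g i j k \<in> carrier L" "finite A"
  shows "(\<Oplus>i\<in>A. \<Oplus>j\<in>A. \<Oplus>k\<in>A. g i j k) = (\<Oplus>k\<in>A. \<Oplus>i\<in>A. \<Oplus>j\<in>A. g i j k)"
proof -
  have "(\<Oplus>i\<in>A. \<Oplus>j\<in>A. \<Oplus>k\<in>A. g i j k) = (\<Oplus>i\<in>A. \<Oplus>k\<in>A. \<Oplus>j\<in>A. g i j k)"
    using assms by (intro finsum_cong' add.finprod_finprod_swap) (auto simp: Pi_def)
  also have "\<dots> = (\<Oplus>k\<in>A. \<Oplus>i\<in>A. \<Oplus>j\<in>A. g i j k)"
    using assms by (intro add.finprod_finprod_swap) (auto simp: Pi_def)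
  finally show ?thesis .
qed

lemma finsum3_add:
  assumes "\<And>i j k. f i j k \<in> carrier L" "\<And>i j k. g i j k \<in> carrier L"
  shows "(\<Oplus>i\<in>A. \<Oplus>j\<in>A. \<Oplus>k\<in>A. f i j k) \<oplus> (\<Oplus>i\<in>A. \<Oplus>j\<in>A. \<Oplus>k\<in>A. g i j k) =
    (\<Oplus>i\<in>A. \<Oplus>j\<in>A. \<Oplus>k\<in>A. f i j k \<oplus> g i j k)"
  using assms by (simp add: finsum_addf Pi_def)

lemma conv_jacobi:
  fixes n :: nat
  assumes x: "\<And>k. x k \<in> carrier L" and y: "\<And>k. y k \<in> carrier L" and z: "\<And>k. z k \<in> carrier L"
  shows "(\<Oplus>i\<in>{..n}. \<lbrakk>x i, \<Oplus>j\<in>{..n - i}. \<lbrakk>y j, z (n - i - j)\<rbrakk>\<rbrakk>) \<oplus>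
     (\<Oplus>i\<in>{..n}. \<lbrakk>y i, \<Oplus>j\<in>{..n - i}. \<lbrakk>z j, x (n - i - j)\<rbrakk>\<rbrakk>) \<oplus>
     (\<Oplus>i\<in>{..n}. \<lbrakk>z i, \<Oplus>j\<in>{..n - i}. \<lbrakk>x j, y (n - i - j)\<rbrakk>\<rbrakk>) = \<zero>" (is "?X \<oplus> ?Y \<oplus> ?Z = _")
proof -
  let ?A = "{..n}"
  note c = x y z
  have X: "?X = (\<Oplus>i\<in>?A. \<Oplus>j\<in>?A. \<Oplus>k\<in>?A. if i + j + k = n then \<lbrakk>x i, \<lbrakk>y j, z k\<rbrakk>\<rbrakk> else \<zero>)"
    by (intro conv_eq3 c)
  have "?Y = (\<Oplus>j\<in>?A. \<Oplus>k\<in>?A. \<Oplus>i\<in>?A. if j + k + i = n then \<lbrakk>y j, \<lbrakk>z k, x i\<rbrakk>\<rbrakk> else \<zero>)"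
    by (intro conv_eq3 c)
  also have "\<dots> = (\<Oplus>i\<in>?A. \<Oplus>j\<in>?A. \<Oplus>k\<in>?A. if j + k + i = n then \<lbrakk>y j, \<lbrakk>z k, x i\<rbrakk>\<rbrakk> else \<zero>)"
    by (rule finsum3_cyc) (auto simp: c)
  finally have Y: "?Y = \<dots>" .
  have "?Z = (\<Oplus>k\<in>?A. \<Oplus>i\<in>?A. \<Oplus>j\<in>?A. if k + i + j = n then \<lbrakk>z k, \<lbrakk>x i, y j\<rbrakk>\<rbrakk> else \<zero>)"
    by (intro conv_eq3 c)
  also have "\<dots> = (\<Oplus>i\<in>?A. \<Oplus>j\<in>?A. \<Oplus>k\<in>?A. if k + i + j = n then \<lbrakk>z k, \<lbrakk>x i, y j\<rbrakk>\<rbrakk> else \<zero>)"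
    by (rule finsum3_cyc[symmetric]) (auto simp: c)
  finally have Z: "?Z = \<dots>" .
  let ?S = "\<lambda>i j k. (if i + j + k = n then \<lbrakk>x i, \<lbrakk>y j, z k\<rbrakk>\<rbrakk> else \<zero>) \<oplus>
    (if j + k + i = n then \<lbrakk>y j, \<lbrakk>z k, x i\<rbrakk>\<rbrakk> else \<zero>) \<oplus>
    (if k + i + j = n then \<lbrakk>z k, \<lbrakk>x i, y j\<rbrakk>\<rbrakk> else \<zero>)"
  have S: "?S i j k = \<zero>" for i j k
  proof (cases "i + j + k = n")
    case True
    then have "j + k + i = n" "k + i + j = n" by simp_all
    with True show ?thesis using jacobi[OF x y z] by simp
  next
    case False
    then have "j + k + i \<noteq> n" "k + i + j \<noteq> n" by simp_all
    with False show ?thesis by simp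
  qed
  have "?X \<oplus> ?Y \<oplus> ?Z = (\<Oplus>i\<in>?A. \<Oplus>j\<in>?A. \<Oplus>k\<in>?A. ?S i j k)"
    unfolding X Y Z by (subst finsum3_add, simp_all add: c)+
  also have "\<dots> = \<zero>" unfolding S by simp
  finally show ?thesis .
qed

lemma conv_self:
  fixes n :: nat
  assumes "\<And>k. x k \<in> carrier L"
  shows "(\<Oplus>i\<in>{..n}. \<lbrakk>x i, x (n - i)\<rbrakk>) = \<zero>"
  using assms
proof (induction n arbitrary: x rule: induct_nat_012)
  case 0
  then show ?case by (simp add: bracket_self)
next
  case 1
  then show ?case using bracket_skew[of "x 0" "x 1"] by (simp add: finsum_Suc l_neg)
next
  case (ge2 n)
  have c: "\<And>k. x k \<in> carrier L" by fact
  have "(\<Oplus>i\<in>{..Suc (Suc n)}. \<lbrakk>x i, x (Suc (Suc n) - i)\<rbrakk>) =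
     \<lbrakk>x (Suc (Suc n)), x 0\<rbrakk> \<oplus> ((\<Oplus>i\<in>{..n}. \<lbrakk>x (Suc i), x (Suc n - i)\<rbrakk>) \<oplus> \<lbrakk>x 0, x (Suc (Suc n))\<rbrakk>)"
    using c by (subst finsum_Suc, force, subst finsum_Suc2) auto
  also have "(\<Oplus>i\<in>{..n}. \<lbrakk>x (Suc i), x (Suc n - i)\<rbrakk>) = (\<Oplus>i\<in>{..n}. \<lbrakk>x (Suc i), x (Suc (n - i))\<rbrakk>)"
    using c by (intro finsum_cong') (auto simp: Suc_diff_le)
  also have "\<dots> = \<zero>" using ge2.IH(1)[of "\<lambda>i. x (Suc i)"] c by simp
  finally show ?case using c bracket_skew[of "x 0" "x (Suc (Suc n))"] by (simp add: l_neg)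
qed

lemma takiff_inf_vectorspace: "vectorspace K (takiff_inf L)"
proof -
  have "module K (takiff_inf L)"
  proof (rule module_criteria, goal_cases)
    case 3
    show ?case
    proof (intro allI impI)
      fix v w assume "v \<in> carrier (takiff_inf L) \<and> w \<in> carrier (takiff_inf L)"
      then have "finite ({k. v k \<noteq> \<zero>} \<union> {k. w k \<noteq> \<zero>})" by (simp add: takiff_inf_def)
      then have "finite {k. v k \<oplus> w k \<noteq> \<zero>}" by (rule rev_finite_subset) auto
      then show "v \<oplus>\<^bsub>takiff_inf L\<^esub> w \<in> carrier (takiff_inf L)"
        using \<open>v \<in> _ \<and> w \<in> _\<close> by (auto simp: takiff_inf_def)
    qed
  next
    case 4
    show ?case
    proof
      fix v assume v: "v \<in> carrier (takiff_inf L)"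
      then have "finite {k. v k \<noteq> \<zero>}" by (simp add: takiff_inf_def)
      then have "finite {k. \<ominus> v k \<noteq> \<zero>}" by (rule rev_finite_subset) auto
      then show "\<exists>w\<in>carrier (takiff_inf L). v \<oplus>\<^bsub>takiff_inf L\<^esub> w = \<zero>\<^bsub>takiff_inf L\<^esub>"
        using v by (intro bexI[of _ "\<lambda>k. \<ominus> v k"]) (auto simp: takiff_inf_def r_neg)
    qed
  next
    case 5
    show ?case
    proof (intro allI impI)
      fix a v assume a: "a \<in> carrier K \<and> v \<in> carrier (takiff_inf L)"
      then have "finite {k. v k \<noteq> \<zero>}" by (simp add: takiff_inf_def)
      then have "finite {k. a \<odot> v k \<noteq> \<zero>}" by (rule rev_finite_subset) (use a in auto)
      then show "a \<odot>\<^bsub>takiff_inf L\<^esub> v \<in> carrier (takiff_inf L)"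
        using a by (auto simp: takiff_inf_def)
    qed
  qed (auto simp: takiff_inf_def a_ac smult_assoc1 smult_l_distr smult_r_distr intro: R.is_cring)
  then show ?thesis by (simp add: vectorspace_def field_axioms)
qed

lemma takiff_inf_bracket_closed:
  assumes x: "x \<in> carrier (takiff_inf L)" and y: "y \<in> carrier (takiff_inf L)"
  shows "\<lbrakk>x, y\<rbrakk>\<^bsub>takiff_inf L\<^esub> \<in> carrier (takiff_inf L)"
proof -
  let ?X = "{k. x k \<noteq> \<zero>}" and ?Y = "{k. y k \<noteq> \<zero>}"
  have "(\<Oplus>i\<in>{..k}. \<lbrakk>x i, y (k - i)\<rbrakk>) = \<zero>" if "k \<notin> (\<lambda>(i, j). i + j) ` (?X \<times> ?Y)" for k
  proof (rule add.finprod_one_eqI)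
    fix i assume "i \<in> {..k}"
    with that have "x i = \<zero> \<or> y (k - i) = \<zero>" by force
    then show "\<lbrakk>x i, y (k - i)\<rbrakk> = \<zero>" using takiff_inf_coeff[OF x] takiff_inf_coeff[OF y] by auto
  qed
  then have "{k. (\<Oplus>i\<in>{..k}. \<lbrakk>x i, y (k - i)\<rbrakk>) \<noteq> \<zero>} \<subseteq> (\<lambda>(i, j). i + j) ` (?X \<times> ?Y)" by blast
  moreover have "finite ((\<lambda>(i, j). i + j) ` (?X \<times> ?Y))" using x y by (simp add: takiff_inf_def)
  ultimately have "finite {k. (\<Oplus>i\<in>{..k}. \<lbrakk>x i, y (k - i)\<rbrakk>) \<noteq> \<zero>}" by (rule finite_subset)
  then show ?thesis using takiff_inf_coeff[OF x] takiff_inf_coeff[OF y]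
    by (auto simp: takiff_inf_def)
qed

lemma takiff_inf_lie_algebra: "lie_algebra K (takiff_inf L)"
proof (intro lie_algebra.intro lie_algebra_axioms.intro takiff_inf_vectorspace takiff_inf_bracket_closed)
  fix x y z assume c: "x \<in> carrier (takiff_inf L)" "y \<in> carrier (takiff_inf L)" "z \<in> carrier (takiff_inf L)"
  note c' = c[THEN takiff_inf_coeff]
  show "\<lbrakk>x \<oplus>\<^bsub>takiff_inf L\<^esub> y, z\<rbrakk>\<^bsub>takiff_inf L\<^esub> = \<lbrakk>x, z\<rbrakk>\<^bsub>takiff_inf L\<^esub> \<oplus>\<^bsub>takiff_inf L\<^esub> \<lbrakk>y, z\<rbrakk>\<^bsub>takiff_inf L\<^esub>"
    by (simp add: takiff_inf_def c' bracket_add_left finsum_addf Pi_def)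
  show "\<lbrakk>x, y \<oplus>\<^bsub>takiff_inf L\<^esub> z\<rbrakk>\<^bsub>takiff_inf L\<^esub> = \<lbrakk>x, y\<rbrakk>\<^bsub>takiff_inf L\<^esub> \<oplus>\<^bsub>takiff_inf L\<^esub> \<lbrakk>x, z\<rbrakk>\<^bsub>takiff_inf L\<^esub>"
    by (simp add: takiff_inf_def c' bracket_add_right finsum_addf Pi_def)
  have "(\<lambda>k. \<Oplus>i\<in>{..k}. \<lbrakk>x i, \<Oplus>j\<in>{..k - i}. \<lbrakk>y j, z (k - i - j)\<rbrakk>\<rbrakk>) k \<oplus>
     (\<Oplus>i\<in>{..k}. \<lbrakk>y i, \<Oplus>j\<in>{..k - i}. \<lbrakk>z j, x (k - i - j)\<rbrakk>\<rbrakk>) \<oplus>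
     (\<Oplus>i\<in>{..k}. \<lbrakk>z i, \<Oplus>j\<in>{..k - i}. \<lbrakk>x j, y (k - i - j)\<rbrakk>\<rbrakk>) = \<zero>" for k
    using conv_jacobi[of x y z] c' by simp
  then show "\<lbrakk>x, \<lbrakk>y, z\<rbrakk>\<^bsub>takiff_inf L\<^esub>\<rbrakk>\<^bsub>takiff_inf L\<^esub> \<oplus>\<^bsub>takiff_inf L\<^esub> \<lbrakk>y, \<lbrakk>z, x\<rbrakk>\<^bsub>takiff_inf L\<^esub>\<rbrakk>\<^bsub>takiff_inf L\<^esub>
      \<oplus>\<^bsub>takiff_inf L\<^esub> \<lbrakk>z, \<lbrakk>x, y\<rbrakk>\<^bsub>takiff_inf L\<^esub>\<rbrakk>\<^bsub>takiff_inf L\<^esub> = \<zero>\<^bsub>takiff_inf L\<^esub>"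
    by (simp add: takiff_inf_def)
next
  fix a x y assume c: "a \<in> carrier K" "x \<in> carrier (takiff_inf L)" "y \<in> carrier (takiff_inf L)"
  note c' = c(2,3)[THEN takiff_inf_coeff]
  show "\<lbrakk>a \<odot>\<^bsub>takiff_inf L\<^esub> x, y\<rbrakk>\<^bsub>takiff_inf L\<^esub> = a \<odot>\<^bsub>takiff_inf L\<^esub> \<lbrakk>x, y\<rbrakk>\<^bsub>takiff_inf L\<^esub>"
    by (simp add: takiff_inf_def c c' bracket_smult_left smult_finsum Pi_def)
  show "\<lbrakk>x, a \<odot>\<^bsub>takiff_inf L\<^esub> y\<rbrakk>\<^bsub>takiff_inf L\<^esub> = a \<odot>\<^bsub>takiff_inf L\<^esub> \<lbrakk>x, y\<rbrakk>\<^bsub>takiff_inf L\<^esub>"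
    by (simp add: takiff_inf_def c c' bracket_smult_right smult_finsum Pi_def)
next
  fix x assume "x \<in> carrier (takiff_inf L)"
  then show "\<lbrakk>x, x\<rbrakk>\<^bsub>takiff_inf L\<^esub> = \<zero>\<^bsub>takiff_inf L\<^esub>"
    using conv_self[of x] by (simp add: takiff_inf_def)
qed

lemma takiff_ideal_lie_ideal: "lie_ideal K (takiff_ideal L m) (takiff_inf L)"
proof -
  interpret T: lie_algebra K "takiff_inf L" by (rule takiff_inf_lie_algebra)
  have "submodule K (takiff_ideal L m) (takiff_inf L)"
  proof
    show "takiff_ideal L m \<subseteq> carrier (takiff_inf L)" by (auto simp: takiff_ideal_def)
    show "\<zero>\<^bsub>takiff_inf L\<^esub> \<in> takiff_ideal L m" by (auto simp: takiff_ideal_def takiff_inf_def)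
  next
    fix v w assume "v \<in> takiff_ideal L m" "w \<in> takiff_ideal L m"
    then show "v \<oplus>\<^bsub>takiff_inf L\<^esub> w \<in> takiff_ideal L m"
      using T.add.m_closed[of v w] by (auto simp: takiff_ideal_def) (simp add: takiff_inf_def)
  next
    fix a v assume "a \<in> carrier K" "v \<in> takiff_ideal L m"
    then show "a \<odot>\<^bsub>takiff_inf L\<^esub> v \<in> takiff_ideal L m"
      using T.smult_closed[of a v] by (auto simp: takiff_ideal_def) (simp add: takiff_inf_def)
  qed
  moreover have "\<lbrakk>x, y\<rbrakk>\<^bsub>takiff_inf L\<^esub> \<in> takiff_ideal L m"
    if x: "x \<in> carrier (takiff_inf L)" and y: "y \<in> takiff_ideal L m" for x y
  proof -
    have y': "y \<in> carrier (takiff_inf L)" using y by (simp add: takiff_ideal_def)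
    have "(\<Oplus>i\<in>{..k}. \<lbrakk>x i, y (k - i)\<rbrakk>) = \<zero>" if "k \<le> m" for k
      using y takiff_inf_coeff[OF x] that
      by (intro add.finprod_one_eqI) (auto simp: takiff_ideal_def)
    then show ?thesis using T.bracket_closed[OF x y'] by (auto simp: takiff_ideal_def) (simp add: takiff_inf_def)
  qed
  ultimately show ?thesis
    by (intro lie_ideal.intro lie_ideal_axioms.intro subspace.intro T.lie_algebra_axioms T.vectorspace_axioms)
qed

lemma takiff_lie_algebra: "lie_algebra K (takiff L m)"
  unfolding takiff_def using takiff_ideal_lie_ideal by (rule lie_ideal.lie_quotient_lie_algebra)

text \<open>An element of \<open>takiff L m\<close> is thus the same thing as a tuple \<open>(x\<^sub>0, \<dots>, x\<^sub>m)\<close>.\<close>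

lemma takiff_proj_eq_iff:
  assumes x: "x \<in> carrier (takiff_inf L)" and y: "y \<in> carrier (takiff_inf L)"
  shows "takiff_proj L m x = takiff_proj L m y \<longleftrightarrow> (\<forall>k\<le>m. x k = y k)"
proof -
  interpret I: lie_ideal K "takiff_ideal L m" "takiff_inf L" by (rule takiff_ideal_lie_ideal)
  note xy = takiff_inf_coeff[OF x] takiff_inf_coeff[OF y]
  show ?thesis
  proof
    assume "takiff_proj L m x = takiff_proj L m y"
    then have "x \<in> takiff_ideal L m +>\<^bsub>takiff_inf L\<^esub> y"
      using I.Q.a_rcos_self[OF x] by (simp add: takiff_proj_def)
    then obtain i where "i \<in> takiff_ideal L m" "x = i \<oplus>\<^bsub>takiff_inf L\<^esub> y"
      using y I.coset_elem by blast
    then show "\<forall>k\<le>m. x k = y k" using xy by (auto simp: takiff_ideal_def takiff_inf_def)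
  next
    assume eq: "\<forall>k\<le>m. x k = y k"
    let ?T = "takiff_inf L"
    define d where "d = x \<oplus>\<^bsub>?T\<^esub> (\<ominus>\<^bsub>?T\<^esub> y)"
    have d: "d \<in> carrier ?T" using x y by (simp add: d_def)
    have dy: "d \<oplus>\<^bsub>?T\<^esub> y = x" using x y by (simp add: d_def I.a_assoc I.l_neg)
    have "d k = \<zero>" if "k \<le> m" for k
    proof -
      have "d k \<oplus> y k = \<zero> \<oplus> y k"
        using fun_cong[OF dy, of k] eq that xy by (simp add: takiff_inf_def)
      then show ?thesis using add.right_cancel[of "y k" "d k" \<zero>] xy takiff_inf_coeff[OF d] by simp
    qed
    with d have "d \<in> takiff_ideal L m" unfolding takiff_ideal_def by blast
    from I.coset_eqI[OF this y] show "takiff_proj L m x = takiff_proj L m y"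
      unfolding dy takiff_proj_def .
  qed
qed

end

definition concave_seq :: "(nat \<Rightarrow> real) \<Rightarrow> bool" where
  "concave_seq u \<longleftrightarrow> (\<forall>m. u (m + 2) + u m \<le> 2 * u (m + 1))"

end

theory Submission
  imports Defs "Jordan_Normal_Form.DL_Rank"
begin

text \<open>
  Write \<open>d m\<close> for the dimension of the centralizer of \<open>x(m)\<close> in the truncation modulo \<open>T\<^sup>m\<^sup>+\<^sup>1\<close>, and
  represent this centralizer by the polynomials \<open>y\<close> of degree at most \<open>m\<close> such that
  \<open>\<lbrakk>x, y\<rbrakk>\<close> vanishes modulo \<open>T\<^sup>m\<^sup>+\<^sup>1\<close>. Call this space \<open>C m\<close>.

  Since the bracket is \<open>T\<close>-linear, multiplication by \<open>T\<close> maps \<open>C m\<close> bijectively onto the elements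
  of \<open>C (m + 1)\<close> that have no constant coefficient: for \<open>y = T z\<close>, the condition
  \<open>\<lbrakk>x, y\<rbrakk> \<in> (T\<^sup>m\<^sup>+\<^sup>2)\<close> amounts to \<open>\<lbrakk>x, z\<rbrakk> \<in> (T\<^sup>m\<^sup>+\<^sup>1)\<close>. These elements are the kernel of the linear
  map \<open>y \<mapsto> y\<^sub>0\<close> on \<open>C (m + 1)\<close>. If \<open>P m\<close> denotes the space of constant coefficients of
  elements of \<open>C m\<close>, rank-nullity therefore gives \<open>d (m + 1) - d m = dim (P (m + 1))\<close>
  (\<open>dim_centralizer_space_Suc\<close>).

  Deleting the top coefficient of an element of \<open>C (m + 1)\<close> leaves an element of \<open>C m\<close> with the
  same constant coefficient, so that the spaces \<open>P m\<close> decrease with \<open>m\<close>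
  (\<open>const_coeffs_antimono\<close>). Hence the increments of \<open>d\<close> decrease, which is concavity.
\<close>

section \<open>Finite-dimensional subspaces\<close>

text \<open>
  Independent subsets of \<open>W\<close> stay independent in \<open>V\<close>, so their sizes are bounded by the dimension
  of \<open>V\<close>, and a largest one is a basis of \<open>W\<close>.
\<close>

lemma (in vectorspace) fin_dim_subspace:
  assumes "subspace K W V" "fin_dim"
  shows "vectorspace.fin_dim K (vs W)"
proof -
  interpret W: vectorspace K "vs W" by (rule subspace_is_vs[OF assms(1)])
  have sub: "submodule K W V" using assms(1) by simp
  have WV: "W \<subseteq> carrier V" using submodule.subset[OF sub] .
  have "finite A \<and> card A \<le> dim" if "A \<subseteq> carrier (vs W) \<and> W.lin_indpt A" for A
  proof -
    have "A \<subseteq> W" "A \<subseteq> carrier V" using that WV by auto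
    moreover have "lin_indpt A" using that span_li_not_depend(2)[OF \<open>A \<subseteq> W\<close> sub] by simp
    ultimately show ?thesis using li_le_dim[OF assms(2)] by blast
  qed
  moreover have "W.lin_indpt {}" by (auto simp: W.lin_dep_def)
  ultimately obtain A where A: "finite A" "maximal A (\<lambda>S. S \<subseteq> carrier (vs W) \<and> W.lin_indpt S)"
    using maximal_exists[of "\<lambda>S. S \<subseteq> carrier (vs W) \<and> W.lin_indpt S" dim "{}"] by auto
  then show ?thesis using W.max_li_is_basis[OF A(2)]
    unfolding W.fin_dim_def W.basis_def by blast
qed

lemma (in vectorspace) dim_subspace_mono:
  assumes "subspace K X V" "subspace K W V" "X \<subseteq> W" "vectorspace.fin_dim K (vs W)"
  shows "vectorspace.dim K (vs X) \<le> vectorspace.dim K (vs W)"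
proof -
  interpret W: vectorspace K "vs W" by (rule subspace_is_vs[OF assms(2)])
  have X: "subspace K X (vs W)" by (rule nested_subspaces[OF assms(2,1,3)])
  show ?thesis using W.subspace_dim[OF X assms(4)] W.fin_dim_subspace[OF X assms(4)] by simp
qed

text \<open>
  Generators of the kernel together with preimages of generators of the image span a subspace \<open>U\<close>
  that contains the kernel and has full image, and such a subspace is everything. The rank-nullity
  theorem presupposes that the domain is finite-dimensional; this lemma is what supplies that
  hypothesis in the induction over the order of truncation.
\<close>

lemma (in linear_map) fin_dim_if_ker_and_image:
  assumes "vectorspace.fin_dim K (V.vs kerT)" "vectorspace.fin_dim K (W.vs imT)"
  shows "V.fin_dim"
proof -
  interpret ker: vectorspace K "V.vs kerT" by (rule V.subspace_is_vs[OF kerT_is_subspace])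
  interpret im: vectorspace K "W.vs imT" by (rule W.subspace_is_vs[OF imT_is_subspace])
  obtain A where A: "finite A" "A \<subseteq> kerT" "ker.gen_set A"
    using assms(1) unfolding ker.fin_dim_def by auto
  obtain B where B: "finite B" "B \<subseteq> imT" "im.gen_set B"
    using assms(2) unfolding im.fin_dim_def by auto
  obtain B' where B': "finite B'" "B' \<subseteq> carrier V" "B = T ` B'"
    using finite_subset_image[OF B(1), of T "carrier V"] B(2) unfolding im_def by auto
  have AV: "A \<union> B' \<subseteq> carrier V" using A(2) B'(2) by (auto simp: ker_def)
  define U where "U = V.module.span (A \<union> B')"
  have U: "submodule K U V" unfolding U_def by (rule V.module.span_is_submodule[OF AV])
  have UV: "U \<subseteq> carrier V" using submodule.subset[OF U] .
  have ABU: "A \<union> B' \<subseteq> U" unfolding U_def by (rule V.module.in_own_span[OF AV])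
  have kerU: "kerT \<subseteq> U"
  proof -
    have "V.module.span A = kerT"
      using A V.module.span_li_not_depend(1)[of A kerT] ker_is_submodule by simp
    then show ?thesis using V.module.span_is_subset[of A U] ABU U by auto
  qed
  have TU: "submodule K (T ` U) W"
  proof (unfold_locales, goal_cases)
    case 1 show ?case using UV by auto
  next
    case (2 v w)
    then obtain v' w' where "v = T v'" "w = T w'" and U': "v' \<in> U" "w' \<in> U" by blast
    then have "v \<oplus>\<^bsub>W\<^esub> w = T (v' \<oplus>\<^bsub>V\<^esub> w')" using T_add UV by (metis subsetD)
    then show ?case using submodule.m_closed[OF U U'] by blast
  next
    case 3 show ?case using submodule.zero_closed[OF U] T0_is_0 by (metis image_eqI)
  next
    case (4 c v)
    then obtain v' where "v = T v'" and U': "v' \<in> U" by blast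
    then have "c \<odot>\<^bsub>W\<^esub> v = T (c \<odot>\<^bsub>V\<^esub> v')" using T_smult[OF 4(1)] UV by (metis subsetD)
    then show ?case using submodule.smult_closed[OF U 4(1) U'] by blast
  qed
  have imU: "imT \<subseteq> T ` U"
  proof -
    have "W.module.span B = imT"
      using B W.module.span_li_not_depend(1)[of B imT] im_is_submodule by simp
    then show ?thesis using W.module.span_is_subset[of B "T ` U", OF _ TU] ABU B'(3) by blast
  qed
  have "carrier V \<subseteq> U"
  proof
    fix v assume v: "v \<in> carrier V"
    then have "T v \<in> T ` U" using imU by (auto simp: im_def)
    then obtain u where u: "u \<in> U" "T v = T u" by auto
    have uV: "u \<in> carrier V" using u UV by auto
    have "v \<ominus>\<^bsub>V\<^esub> u \<in> kerT"
      using u v uV by (simp add: ker_def T_minus W.module.M.minus_eq W.module.M.r_neg)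
    then have "(v \<ominus>\<^bsub>V\<^esub> u) \<oplus>\<^bsub>V\<^esub> u \<in> U" using kerU u submodule.m_closed[OF U] by auto
    moreover have "(v \<ominus>\<^bsub>V\<^esub> u) \<oplus>\<^bsub>V\<^esub> u = v"
      using v uV by (simp add: V.module.M.minus_eq V.module.M.a_assoc V.module.M.l_neg)
    ultimately show "v \<in> U" by simp
  qed
  then have "V.module.gen_set (A \<union> B')" using UV unfolding U_def by auto
  then show ?thesis unfolding V.fin_dim_def using A(1) B'(1) AV by blast
qed

lemma linear_mapI:
  assumes "vectorspace K V" "vectorspace K W"
    and "\<And>v. v \<in> carrier V \<Longrightarrow> T v \<in> carrier W"
    and "\<And>v w. \<lbrakk>v \<in> carrier V; w \<in> carrier V\<rbrakk> \<Longrightarrow> T (v \<oplus>\<^bsub>V\<^esub> w) = T v \<oplus>\<^bsub>W\<^esub> T w"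
    and "\<And>a v. \<lbrakk>a \<in> carrier K; v \<in> carrier V\<rbrakk> \<Longrightarrow> T (a \<odot>\<^bsub>V\<^esub> v) = a \<odot>\<^bsub>W\<^esub> T v"
  shows "linear_map K V W T"
  using assms
  by (simp add: linear_map_def mod_hom_def mod_hom_axioms_def vectorspace_def
      LinearCombinations.module_hom_def)

section \<open>Centralizers of truncations\<close>

context lie_algebra
begin

abbreviation Linf where "Linf \<equiv> takiff_inf L"

text \<open>
  The centralizer of the image of \<open>x\<close> in \<open>takiff L m\<close>, with each coset replaced by its unique
  representative of degree at most \<open>m\<close>. Working with sequences instead of cosets makes the
  multiplication by \<open>T\<close> and the constant coefficient plain functions.
\<close>

definition truncated_centralizer :: "(nat \<Rightarrow> 'v) \<Rightarrow> nat \<Rightarrow> (nat \<Rightarrow> 'v) set" where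
  "truncated_centralizer x m =
     {y \<in> carrier Linf. (\<forall>k>m. y k = \<zero>) \<and> (\<forall>k\<le>m. \<lbrakk>x, y\<rbrakk>\<^bsub>Linf\<^esub> k = \<zero>)}"

definition const_coeffs :: "(nat \<Rightarrow> 'v) \<Rightarrow> nat \<Rightarrow> 'v set" where
  "const_coeffs x m = (\<lambda>y. y 0) ` truncated_centralizer x m"

definition mult_T :: "(nat \<Rightarrow> 'v) \<Rightarrow> nat \<Rightarrow> 'v" where
  "mult_T y k = (case k of 0 \<Rightarrow> \<zero> | Suc j \<Rightarrow> y j)"

definition truncate :: "nat \<Rightarrow> (nat \<Rightarrow> 'v) \<Rightarrow> nat \<Rightarrow> 'v" where
  "truncate m y k = (if k \<le> m then y k else \<zero>)"

lemma Linf_simps: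
  "(y \<oplus>\<^bsub>Linf\<^esub> z) k = y k \<oplus> z k" "(a \<odot>\<^bsub>Linf\<^esub> y) k = a \<odot> y k" "\<zero>\<^bsub>Linf\<^esub> k = \<zero>"
  "\<lbrakk>y, z\<rbrakk>\<^bsub>Linf\<^esub> k = (\<Oplus>i\<in>{..k}. \<lbrakk>y i, z (k - i)\<rbrakk>)"
  by (simp_all add: takiff_inf_def)

lemma Linf_bracket_cong:
  assumes "x \<in> carrier Linf" "z \<in> carrier Linf" "\<And>k. k \<le> m \<Longrightarrow> y k = z k" "k \<le> m"
  shows "\<lbrakk>x, y\<rbrakk>\<^bsub>Linf\<^esub> k = \<lbrakk>x, z\<rbrakk>\<^bsub>Linf\<^esub> k"
  unfolding Linf_simps using assms takiff_inf_coeff by (intro finsum_cong') auto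

lemma mult_T_simps [simp]: "mult_T y 0 = \<zero>" "mult_T y (Suc k) = y k"
  by (simp_all add: mult_T_def)

lemma inj_mult_T: "inj_on mult_T A"
  by (metis inj_onI mult_T_simps(2) ext)

lemma mult_T_closed: "y \<in> carrier Linf \<Longrightarrow> mult_T y \<in> carrier Linf"
proof -
  assume y: "y \<in> carrier Linf"
  have "{k. mult_T y k \<noteq> \<zero>} \<subseteq> Suc ` {k. y k \<noteq> \<zero>}"
  proof
    fix k assume "k \<in> {k. mult_T y k \<noteq> \<zero>}"
    then show "k \<in> Suc ` {k. y k \<noteq> \<zero>}" by (cases k) auto
  qed
  then have "finite {k. mult_T y k \<noteq> \<zero>}"
    using y by (auto simp: takiff_inf_def intro: finite_subset)
  then show ?thesis using y by (auto simp: takiff_inf_def mult_T_def split: nat.splits)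
qed

lemma div_T_closed: "y \<in> carrier Linf \<Longrightarrow> (\<lambda>k. y (Suc k)) \<in> carrier Linf"
  using finite_vimageI[of "{k. y k \<noteq> \<zero>}" Suc] by (auto simp: takiff_inf_def vimage_def)

lemma truncate_closed: "y \<in> carrier Linf \<Longrightarrow> truncate m y \<in> carrier Linf"
  by (auto simp: takiff_inf_def truncate_def elim!: rev_finite_subset)

text \<open>
  This is the \<open>T\<close>-linearity of \<open>\<lbrakk>x, _\<rbrakk>\<close>: in the convolution for the coefficient of \<open>T\<^sup>n\<^sup>+\<^sup>1\<close>, the summand
  that involves the constant coefficient of \<open>mult_T y\<close> vanishes, and the others are those of the
  coefficient of \<open>T\<^sup>n\<close> in \<open>\<lbrakk>x, y\<rbrakk>\<close>.
\<close>

lemma bracket_mult_T: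
  assumes "x \<in> carrier Linf" "y \<in> carrier Linf"
  shows "\<lbrakk>x, mult_T y\<rbrakk>\<^bsub>Linf\<^esub> = mult_T \<lbrakk>x, y\<rbrakk>\<^bsub>Linf\<^esub>"
proof
  fix k
  note c = assms[THEN takiff_inf_coeff]
  show "\<lbrakk>x, mult_T y\<rbrakk>\<^bsub>Linf\<^esub> k = mult_T \<lbrakk>x, y\<rbrakk>\<^bsub>Linf\<^esub> k"
  proof (cases k)
    case 0 then show ?thesis using c by (simp add: Linf_simps)
  next
    case (Suc n)
    have "(\<Oplus>i\<in>{..n}. \<lbrakk>x i, mult_T y (Suc n - i)\<rbrakk>) = (\<Oplus>i\<in>{..n}. \<lbrakk>x i, y (n - i)\<rbrakk>)"
      using c by (intro finsum_cong') (auto simp: Suc_diff_le)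
    then show ?thesis
      using c takiff_inf_coeff[OF mult_T_closed[OF assms(2)]] unfolding Suc mult_T_simps Linf_simps
      by (subst finsum_Suc) auto
  qed
qed

lemma truncated_centralizer_subspace:
  assumes "x \<in> carrier Linf"
  shows "subspace K (truncated_centralizer x m) Linf"
proof -
  interpret T: lie_algebra K Linf by (rule takiff_inf_lie_algebra)
  have "submodule K (truncated_centralizer x m) Linf"
  proof (unfold_locales, goal_cases)
    case 1 show ?case by (auto simp: truncated_centralizer_def)
  next
    case (2 v w) then show ?case using assms
      by (auto simp: truncated_centralizer_def T.bracket_add_right Linf_simps(1))
  next
    case 3 show ?case using assms by (auto simp: truncated_centralizer_def Linf_simps(3))
  next
    case (4 c v) then show ?case using assms
      by (auto simp: truncated_centralizer_def T.bracket_smult_right Linf_simps(2))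
  qed
  then show ?thesis by (simp add: subspace_def T.vectorspace_axioms)
qed

lemma truncate_centralizes:
  assumes "x \<in> carrier Linf" "y \<in> carrier Linf" "\<And>k. k \<le> m \<Longrightarrow> \<lbrakk>x, y\<rbrakk>\<^bsub>Linf\<^esub> k = \<zero>"
  shows "truncate m y \<in> truncated_centralizer x m"
proof -
  have "\<lbrakk>x, truncate m y\<rbrakk>\<^bsub>Linf\<^esub> k = \<lbrakk>x, y\<rbrakk>\<^bsub>Linf\<^esub> k" if "k \<le> m" for k
    using that by (intro Linf_bracket_cong[OF assms(1,2)]) (auto simp: truncate_def)
  then show ?thesis using assms truncate_closed
    by (auto simp: truncated_centralizer_def) (simp add: truncate_def)
qed

text \<open>
  An element that centralizes \<open>x\<close> to order \<open>m + 1\<close> does so to order \<open>m\<close>, and truncating it does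
  not touch its constant coefficient.
\<close>

lemma const_coeffs_antimono:
  assumes "x \<in> carrier Linf"
  shows "const_coeffs x (Suc m) \<subseteq> const_coeffs x m"
proof
  fix a assume "a \<in> const_coeffs x (Suc m)"
  then obtain y where y: "y \<in> truncated_centralizer x (Suc m)" "a = y 0"
    by (auto simp: const_coeffs_def)
  then have "truncate m y \<in> truncated_centralizer x m"
    using assms by (intro truncate_centralizes) (auto simp: truncated_centralizer_def)
  moreover have "truncate m y 0 = a" using y by (simp add: truncate_def)
  ultimately show "a \<in> const_coeffs x m" unfolding const_coeffs_def by blast
qed

text \<open>
  An element without constant coefficient is \<open>T\<close> times a unique \<open>y\<close>, and dividing by \<open>T\<close> lowers
  both its degree and the order to which it centralizes \<open>x\<close> by one.
\<close>

lemma mult_T_image: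
  assumes "x \<in> carrier Linf"
  shows "mult_T ` truncated_centralizer x m = {y \<in> truncated_centralizer x (Suc m). y 0 = \<zero>}"
proof (intro equalityI subsetI)
  fix z assume "z \<in> mult_T ` truncated_centralizer x m"
  then obtain y where y: "y \<in> truncated_centralizer x m" "z = mult_T y" by auto
  have "mult_T y k = \<zero>" if "k > Suc m" for k
    using y that by (cases k) (auto simp: truncated_centralizer_def)
  moreover have "mult_T \<lbrakk>x, y\<rbrakk>\<^bsub>Linf\<^esub> k = \<zero>" if "k \<le> Suc m" for k
    using y that by (cases k) (auto simp: truncated_centralizer_def)
  ultimately show "z \<in> {y \<in> truncated_centralizer x (Suc m). y 0 = \<zero>}"
    using y assms mult_T_closed
    by (simp add: truncated_centralizer_def bracket_mult_T)
next
  fix z assume z: "z \<in> {y \<in> truncated_centralizer x (Suc m). y 0 = \<zero>}"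
  define y where "y = (\<lambda>k. z (Suc k))"
  have zy: "z = mult_T y"
    using z by (auto simp: y_def mult_T_def fun_eq_iff split: nat.splits)
  have y: "y \<in> carrier Linf"
    using z div_T_closed unfolding y_def truncated_centralizer_def by blast
  have "\<lbrakk>x, y\<rbrakk>\<^bsub>Linf\<^esub> k = \<zero>" if "k \<le> m" for k
  proof -
    have "\<lbrakk>x, z\<rbrakk>\<^bsub>Linf\<^esub> (Suc k) = \<zero>" using z that by (simp add: truncated_centralizer_def)
    then show ?thesis by (simp add: zy bracket_mult_T[OF assms y])
  qed
  moreover have "y k = \<zero>" if "k > m" for k
    using z that by (simp add: truncated_centralizer_def y_def)
  ultimately have "y \<in> truncated_centralizer x m" using y by (simp add: truncated_centralizer_def)
  then show "z \<in> mult_T ` truncated_centralizer x m" using zy by blast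
qed

section \<open>Growth of the centralizer dimension\<close>

abbreviation centralizer_space where
  "centralizer_space x m \<equiv> Linf\<lparr>carrier := truncated_centralizer x m\<rparr>"

lemma centralizer_space_vectorspace:
  assumes "x \<in> carrier Linf"
  shows "vectorspace K (centralizer_space x m)"
  by (rule vectorspace.subspace_is_vs[OF takiff_inf_vectorspace truncated_centralizer_subspace[OF assms]])

lemma const_coeff_linear:
  assumes "x \<in> carrier Linf"
  shows "linear_map K (centralizer_space x m) L (\<lambda>y. y 0)"
  by (rule linear_mapI[OF centralizer_space_vectorspace[OF assms] vectorspace_axioms])
    (simp_all add: Linf_simps(1,2) truncated_centralizer_def takiff_inf_coeff)

lemma const_coeff_image:
  assumes "x \<in> carrier Linf"
  shows "mod_hom.im (centralizer_space x m) (\<lambda>y. y 0) = const_coeffs x m"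
proof -
  interpret linear_map K "centralizer_space x m" L "\<lambda>y. y 0" by (rule const_coeff_linear[OF assms])
  show ?thesis by (simp add: im_def const_coeffs_def)
qed

lemma const_coeff_kernel:
  assumes "x \<in> carrier Linf"
  shows "mod_hom.ker (centralizer_space x m) L (\<lambda>y. y 0) = {y \<in> truncated_centralizer x m. y 0 = \<zero>}"
proof -
  interpret linear_map K "centralizer_space x m" L "\<lambda>y. y 0" by (rule const_coeff_linear[OF assms])
  show ?thesis by (simp add: ker_def)
qed

lemma const_coeffs_subspace:
  assumes "x \<in> carrier Linf"
  shows "subspace K (const_coeffs x m) L"
proof -
  interpret linear_map K "centralizer_space x m" L "\<lambda>y. y 0" by (rule const_coeff_linear[OF assms])
  show ?thesis using imT_is_subspace by (simp add: const_coeff_image[OF assms])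
qed

lemma mult_T_linear:
  assumes "x \<in> carrier Linf"
  shows "linear_map K (centralizer_space x m)
    (Linf\<lparr>carrier := {y \<in> truncated_centralizer x (Suc m). y 0 = \<zero>}\<rparr>) mult_T"
proof -
  interpret ev: linear_map K "centralizer_space x (Suc m)" L "\<lambda>y. y 0"
    by (rule const_coeff_linear[OF assms])
  have W: "vectorspace K (Linf\<lparr>carrier := {y \<in> truncated_centralizer x (Suc m). y 0 = \<zero>}\<rparr>)"
    using ev.V.subspace_is_vs[OF ev.kerT_is_subspace] by (simp add: const_coeff_kernel[OF assms])
  show ?thesis
  proof (rule linear_mapI[OF centralizer_space_vectorspace[OF assms] W])
    fix v assume "v \<in> carrier (centralizer_space x m)"
    then show "mult_T v \<in> carrier (Linf\<lparr>carrier := {y \<in> truncated_centralizer x (Suc m). y 0 = \<zero>}\<rparr>)"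
      using mult_T_image[OF assms, of m] by auto
  qed (auto simp: fun_eq_iff mult_T_def Linf_simps split: nat.splits)
qed

text \<open>
  By induction on \<open>m\<close>, applied to the map \<open>y \<mapsto> y\<^sub>0\<close>: its image lies in the finite-dimensional
  space \<open>L\<close>, and its kernel is zero for \<open>m = 0\<close> and otherwise the previous space, multiplied
  by \<open>T\<close>.
\<close>

lemma centralizer_space_fin_dim:
  assumes "x \<in> carrier Linf" "fin_dim"
  shows "vectorspace.fin_dim K (centralizer_space x m)"
proof (induction m)
  case 0
  interpret ev: linear_map K "centralizer_space x 0" L "\<lambda>y. y 0"
    by (rule const_coeff_linear[OF assms(1)])
  interpret ker: vectorspace K "ev.V.vs ev.kerT" by (rule ev.V.subspace_is_vs[OF ev.kerT_is_subspace])
  have "y = \<zero>\<^bsub>Linf\<^esub>" if "y \<in> ev.kerT" for y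
  proof
    fix k
    have "\<forall>k>0. y k = \<zero>" "y 0 = \<zero>"
      using that by (simp_all add: const_coeff_kernel[OF assms(1)])
        (simp add: truncated_centralizer_def)
    then show "y k = \<zero>\<^bsub>Linf\<^esub> k" by (cases k) (simp_all add: Linf_simps(3))
  qed
  moreover have "\<zero>\<^bsub>Linf\<^esub> \<in> ev.kerT" using ker.zero_closed by simp
  ultimately have "ev.kerT = {\<zero>\<^bsub>Linf\<^esub>}" by blast
  then have "ker.gen_set {}" unfolding ker.span_empty by simp
  then have "ker.fin_dim" unfolding ker.fin_dim_def by blast
  then show ?case
    by (rule ev.fin_dim_if_ker_and_image) (rule fin_dim_subspace[OF ev.imT_is_subspace assms(2)])
next
  case (Suc m)
  interpret ev: linear_map K "centralizer_space x (Suc m)" L "\<lambda>y. y 0"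
    by (rule const_coeff_linear[OF assms(1)])
  interpret sh: linear_map K "centralizer_space x m"
    "Linf\<lparr>carrier := {y \<in> truncated_centralizer x (Suc m). y 0 = \<zero>}\<rparr>" mult_T
    by (rule mult_T_linear[OF assms(1)])
  have "vectorspace.fin_dim K (ev.V.vs ev.kerT)"
    using sh.surj_fin_dim[OF Suc] mult_T_image[OF assms(1)] by (simp add: const_coeff_kernel[OF assms(1)])
  then show ?case
    by (rule ev.fin_dim_if_ker_and_image) (rule fin_dim_subspace[OF ev.imT_is_subspace assms(2)])
qed

lemma dim_centralizer_space_Suc:
  assumes "x \<in> carrier Linf" "fin_dim"
  shows "vectorspace.dim K (centralizer_space x (Suc m)) =
    vectorspace.dim K (centralizer_space x m) + vectorspace.dim K (vs (const_coeffs x (Suc m)))"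
proof -
  interpret ev: linear_map K "centralizer_space x (Suc m)" L "\<lambda>y. y 0"
    by (rule const_coeff_linear[OF assms(1)])
  interpret sh: linear_map K "centralizer_space x m"
    "Linf\<lparr>carrier := {y \<in> truncated_centralizer x (Suc m). y 0 = \<zero>}\<rparr>" mult_T
    by (rule mult_T_linear[OF assms(1)])
  have "vectorspace.dim K (ev.V.vs ev.kerT) = vectorspace.dim K (centralizer_space x m)"
    using sh.dim_eq[OF centralizer_space_fin_dim[OF assms] inj_mult_T] mult_T_image[OF assms(1)]
    by (simp add: const_coeff_kernel[OF assms(1)])
  then show ?thesis
    using ev.rank_nullity[OF centralizer_space_fin_dim[OF assms]]
    by (simp add: const_coeff_image[OF assms(1)])
qed

section \<open>Comparison with the Takiff algebras\<close>

lemma takiff_proj_linear: "linear_map K Linf (takiff L m) (takiff_proj L m)"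
proof -
  interpret I: lie_ideal K "takiff_ideal L m" Linf by (rule takiff_ideal_lie_ideal)
  interpret Q: lie_algebra K "takiff L m" by (rule takiff_lie_algebra)
  show ?thesis
    by (rule linear_mapI[OF takiff_inf_vectorspace Q.vectorspace_axioms])
      (simp_all only: takiff_def takiff_proj_def I.quotient_in_carrier I.quotient_add I.quotient_smult)
qed

text \<open>
  Each coset contains exactly one polynomial of degree at most \<open>m\<close>, and it centralizes the image of
  \<open>x\<close> exactly when the bracket of representatives vanishes modulo \<open>T\<^sup>m\<^sup>+\<^sup>1\<close>.
\<close>

lemma takiff_proj_truncated_centralizer:
  assumes "x \<in> carrier Linf"
  shows "bij_betw (takiff_proj L m) (truncated_centralizer x m)
    (lie_centralizer (takiff L m) (takiff_proj L m x))"
proof -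
  interpret I: lie_ideal K "takiff_ideal L m" Linf by (rule takiff_ideal_lie_ideal)
  interpret T: lie_algebra K Linf by (rule takiff_inf_lie_algebra)
  have centralizes: "\<lbrakk>takiff_proj L m x, takiff_proj L m y\<rbrakk>\<^bsub>takiff L m\<^esub> = \<zero>\<^bsub>takiff L m\<^esub> \<longleftrightarrow>
      (\<forall>k\<le>m. \<lbrakk>x, y\<rbrakk>\<^bsub>Linf\<^esub> k = \<zero>)" if y: "y \<in> carrier Linf" for y
  proof -
    have "\<lbrakk>takiff_proj L m x, takiff_proj L m y\<rbrakk>\<^bsub>takiff L m\<^esub> = takiff_proj L m \<lbrakk>x, y\<rbrakk>\<^bsub>Linf\<^esub>"
      "\<zero>\<^bsub>takiff L m\<^esub> = takiff_proj L m \<zero>\<^bsub>Linf\<^esub>"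
      using assms y
      by (simp_all only: takiff_def takiff_proj_def I.quotient_bracket I.quotient_zero)
    then show ?thesis
      using takiff_proj_eq_iff[of "\<lbrakk>x, y\<rbrakk>\<^bsub>Linf\<^esub>" "\<zero>\<^bsub>Linf\<^esub>" m] assms y by (simp add: Linf_simps(3))
  qed
  have carrier: "carrier (takiff L m) = takiff_proj L m ` carrier Linf"
    by (simp add: takiff_def takiff_proj_def I.quotient_carrier)
  show ?thesis
  proof (rule bij_betw_imageI)
    show "inj_on (takiff_proj L m) (truncated_centralizer x m)"
    proof (rule inj_onI, rule ext)
      fix y z k assume yz: "y \<in> truncated_centralizer x m" "z \<in> truncated_centralizer x m"
        "takiff_proj L m y = takiff_proj L m z"
      then show "y k = z k"
        using takiff_proj_eq_iff[of y z m] by (cases "k \<le> m") (auto simp: truncated_centralizer_def)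
    qed
    show "takiff_proj L m ` truncated_centralizer x m = lie_centralizer (takiff L m) (takiff_proj L m x)"
    proof (intro equalityI subsetI)
      fix Y assume "Y \<in> takiff_proj L m ` truncated_centralizer x m"
      then show "Y \<in> lie_centralizer (takiff L m) (takiff_proj L m x)"
        using centralizes by (auto simp: truncated_centralizer_def lie_centralizer_def carrier)
    next
      fix Y assume Y: "Y \<in> lie_centralizer (takiff L m) (takiff_proj L m x)"
      then obtain y where y: "y \<in> carrier Linf" "Y = takiff_proj L m y"
        by (auto simp: lie_centralizer_def carrier)
      have "truncate m y \<in> truncated_centralizer x m"
        using Y y centralizes by (intro truncate_centralizes assms) (auto simp: lie_centralizer_def)
      moreover have "Y = takiff_proj L m (truncate m y)"
        using y takiff_proj_eq_iff[of y "truncate m y" m] truncate_closed by (simp add: truncate_def)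
      ultimately show "Y \<in> takiff_proj L m ` truncated_centralizer x m" by blast
    qed
  qed
qed

lemma lie_centralizer_subspace:
  assumes "z \<in> carrier L"
  shows "subspace K (lie_centralizer L z) L"
proof -
  have "submodule K (lie_centralizer L z) L"
    by unfold_locales
      (use assms in \<open>auto simp: lie_centralizer_def bracket_add_right bracket_smult_right\<close>)
  then show ?thesis by (simp add: subspace_def vectorspace_axioms)
qed

lemma centralizer_dim_takiff:
  assumes "x \<in> carrier Linf" "fin_dim"
  shows "centralizer_dim K (takiff L m) (takiff_proj L m x) = vectorspace.dim K (centralizer_space x m)"
proof -
  interpret Q: lie_algebra K "takiff L m" by (rule takiff_lie_algebra)
  interpret p: linear_map K Linf "takiff L m" "takiff_proj L m" by (rule takiff_proj_linear)
  let ?Z = "lie_centralizer (takiff L m) (takiff_proj L m x)"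
  have bij: "bij_betw (takiff_proj L m) (truncated_centralizer x m) ?Z"
    by (rule takiff_proj_truncated_centralizer[OF assms(1)])
  have Z: "vectorspace K (takiff L m\<lparr>carrier := ?Z\<rparr>)"
    using assms by (intro Q.subspace_is_vs Q.lie_centralizer_subspace) auto
  have "linear_map K (centralizer_space x m) (takiff L m\<lparr>carrier := ?Z\<rparr>) (takiff_proj L m)"
    by (rule linear_mapI[OF centralizer_space_vectorspace[OF assms(1)] Z])
      (use bij in \<open>auto simp: bij_betw_def truncated_centralizer_def\<close>)
  then show ?thesis
    using linear_map.dim_eq[OF _ centralizer_space_fin_dim[OF assms]] bij
    by (fastforce simp: centralizer_dim_def bij_betw_def)
qed

theorem concave_centralizer_dim_takiff:
  assumes "x \<in> carrier Linf" "fin_dim"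
  shows "concave_seq (\<lambda>m. real (centralizer_dim K (takiff L m) (takiff_proj L m x)))"
  unfolding concave_seq_def
proof
  fix m
  define d where "d m = vectorspace.dim K (centralizer_space x m)" for m
  define p where "p m = vectorspace.dim K (vs (const_coeffs x m))" for m
  have "p (Suc (Suc m)) \<le> p (Suc m)" unfolding p_def
    using assms
    by (intro dim_subspace_mono const_coeffs_subspace const_coeffs_antimono fin_dim_subspace)
  moreover have "d (Suc k) = d k + p (Suc k)" for k
    unfolding d_def p_def by (rule dim_centralizer_space_Suc[OF assms])
  ultimately have "d (m + 2) + d m \<le> 2 * d (m + 1)" by simp
  then show "real (centralizer_dim K (takiff L (m + 2)) (takiff_proj L (m + 2) x)) +
      real (centralizer_dim K (takiff L m) (takiff_proj L m x))
      \<le> 2 * real (centralizer_dim K (takiff L (m + 1)) (takiff_proj L (m + 1) x))"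
    unfolding centralizer_dim_takiff[OF assms] d_def[symmetric] by linarith
qed

end

theorem proposition2p5:
  fixes \<gg> :: "(complex, 'a) lie_algebra" and x :: "nat \<Rightarrow> 'a"
  assumes "quadratic_lie_algebra class_field \<gg>"
    and "vectorspace.fin_dim class_field \<gg>"
    and "x \<in> carrier (takiff_inf \<gg>)"
  shows "concave_seq (\<lambda>m. real (centralizer_dim class_field (takiff \<gg> m) (takiff_proj \<gg> m x)))"
proof -
  interpret quadratic_lie_algebra class_field \<gg> by (rule assms(1))
  show ?thesis by (rule concave_centralizer_dim_takiff[OF assms(3,2)])
qed

end
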